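(* Let $n\ge2$ and $X=\mathrm{Sp}_{2n}(2)$. Let $\Gamma$ be an $X$-strongly incidence-transitive code in $J(\mathcal{Q}^\epsilon,k)$ for some $k$ with $2\le k\le|\mathcal{Q}^\epsilon|-2$, and let $\Delta\in\Gamma$. Suppose $X_\Delta\le X_U$ for some nondegenerate $2d$-dimensional subspace $U$ of $V$, where $1\le d\le n-1$. Then $\Gamma=\Gamma(n,d,\epsilon,\epsilon')$ for some $\epsilon'\in\{+,-\}$, $k=2^{n-2}(2^d+\epsilon')(2^{n-d}+\epsilon\epsilon')$, and $(n,d,\epsilon)\ne(2,1,+)$.
   Context: Let $V=\mathbb{F}_2^{2n}$ with a symplectic (nondegenerate alternating bilinear) form $B$, and $X=\mathrm{Sp}_{2n}(2)$ its isometry group (acting on the right). $\mathcal{Q}$ is the set of quadratic forms $\phi:V\to\mathbb{F}_2$ with $\phi(x+y)+\phi(x)+\phi(y)=B(x,y)$; $\mathcal{Q}^\epsilon$ is the set of those of type $\epsilon\in\{+,-\}$. Signs are identified with $\pm1$ in arithmetic ($|\mathcal{Q}^\epsilon|=2^{n-1}(2^n+\epsilon)$), $\epsilon\epsilon'$ is the product sign. $X$ acts on $\mathcal{Q}^\epsilon$ by $\phi^g(x)=\phi(xg^{-1})$. $U^\perp$ is the $B$-orthogonal complement; $U$ nondegenerate means $U\cap U^\perp=0$; $\phi_U$ is the restriction; $X_U$ the setwise stabiliser of $U$. $J(\mathcal V,k)$: vertices the $k$-subsets of $\mathcal V$, adjacent iff intersection has size $k-1$; a code is a nonempty vertex set;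 $\Gamma$ is $G$-strongly incidence-transitive ($G$ a group of permutations of $\mathcal V$ preserving $\Gamma$) if $G$ is transitive on $\Gamma$ and $G_\Delta$ is transitive on $\Delta\times(\mathcal V\setminus\Delta)$ for each $\Delta\in\Gamma$. $\Gamma(n,d,\epsilon,\epsilon')$ (for $n\ge2$, $1\le d\le n-1$, signs $\epsilon,\epsilon'$, $(n,d,\epsilon)\ne(2,1,+)$) is the code in $J(\mathcal{Q}^\epsilon,2^{n-2}(2^d+\epsilon')(2^{n-d}+\epsilon\epsilon'))$ consisting of $\Delta(U)=\{\phi\in\mathcal{Q}^\epsilon:\phi_U$ of type $\epsilon'$, $\phi_{U^\perp}$ of type $\epsilon\epsilon'\}$ for all nondegenerate $2d$-dimensional $U$. *)

theory Defs
  imports "HOL-Analysis.Cartesian_Space" "HOL-Library.Z2" "HOL-Algebra.Group_Action"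
begin

section \<open>Codes in Johnson graphs\<close>

definition johnson_vertices :: "'p set \<Rightarrow> nat \<Rightarrow> 'p set set" where
  "johnson_vertices P k = {D. D \<subseteq> P \<and> finite D \<and> card D = k}"

definition johnson_code :: "'p set \<Rightarrow> nat \<Rightarrow> 'p set set \<Rightarrow> bool" where
  "johnson_code P k \<Gamma> \<longleftrightarrow> \<Gamma> \<noteq> {} \<and> \<Gamma> \<subseteq> johnson_vertices P k"

definition setwise_stabiliser :: "('g, 'r) monoid_scheme \<Rightarrow> ('g \<Rightarrow> 'p \<Rightarrow> 'p) \<Rightarrow> 'p set \<Rightarrow> 'g set" where
  "setwise_stabiliser G act S = {g \<in> carrier G. act g ` S = S}"

definition strongly_incidence_transitive ::
    "('g, 'r) monoid_scheme \<Rightarrow> ('g \<Rightarrow> 'p \<Rightarrow> 'p) \<Rightarrow> 'p set \<Rightarrow> 'p set set \<Rightarrow> bool" where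
  "strongly_incidence_transitive G act P \<Gamma> \<longleftrightarrow>
     group_action G P act \<and>
     (\<forall>g \<in> carrier G. \<forall>D \<in> \<Gamma>. act g ` D \<in> \<Gamma>) \<and>
     (\<forall>D \<in> \<Gamma>. \<forall>D' \<in> \<Gamma>. \<exists>g \<in> carrier G. act g ` D = D') \<and>
     (\<forall>D \<in> \<Gamma>. \<forall>a \<in> D. \<forall>b \<in> P - D. \<forall>a' \<in> D. \<forall>b' \<in> P - D.
        \<exists>g \<in> setwise_stabiliser G act D. act g a = a' \<and> act g b = b')"


section \<open>Symplectic geometry over the field with two elements\<close>

type_synonym 'm form = "bit ^ 'm \<Rightarrow> bit ^ 'm \<Rightarrow> bit"

definition perp :: "'m::finite form \<Rightarrow> (bit ^ 'm) set \<Rightarrow> (bit ^ 'm) set" where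
  "perp B U = {v. \<forall>u \<in> U. B u v = 0}"

definition nondegenerate_on :: "'m::finite form \<Rightarrow> (bit ^ 'm) set \<Rightarrow> bool" where
  "nondegenerate_on B U \<longleftrightarrow> U \<inter> perp B U = {0}"

definition symplectic_form :: "'m::finite form \<Rightarrow> bool" where
  "symplectic_form B \<longleftrightarrow>
     (\<forall>x. Vector_Spaces.linear (*s) (*) (\<lambda>y. B x y)) \<and>
     (\<forall>y. Vector_Spaces.linear (*s) (*) (\<lambda>x. B x y)) \<and>
     (\<forall>x. B x x = 0) \<and>
     nondegenerate_on B UNIV"

text \<open>
  The right action \<open>x g\<close> is written as function application \<open>g x\<close>, so the group operation
  is composition of maps; stabilisers and orbits do not depend on this choice of side.
\<close>

definition Sp :: "'m::finite form \<Rightarrow> (bit ^ 'm \<Rightarrow> bit ^ 'm) monoid" where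
  "Sp B = \<lparr>carrier = {g. Vector_Spaces.linear (*s) (*s) g \<and> bij g \<and> (\<forall>x y. B (g x) (g y) = B x y)},
           mult = (\<lambda>g h. g \<circ> h), one = id\<rparr>"

definition quadratic_forms :: "'m::finite form \<Rightarrow> (bit ^ 'm \<Rightarrow> bit) set" where
  "quadratic_forms B = {\<phi>. (\<forall>a x. \<phi> (a *s x) = a\<^sup>2 * \<phi> x) \<and>
                             (\<forall>x y. \<phi> (x + y) + \<phi> x + \<phi> y = B x y)}"

definition witt_index :: "(bit ^ 'm::finite \<Rightarrow> bit) \<Rightarrow> (bit ^ 'm) set \<Rightarrow> nat" where
  "witt_index \<phi> U = Max {vec.dim W | W. vec.subspace W \<and> W \<subseteq> U \<and> (\<forall>w \<in> W. \<phi> w = 0)}"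

text \<open>
  Type of the restriction of \<open>\<phi>\<close> to a nondegenerate subspace \<open>U\<close> of dimension \<open>2 m\<close>:
  plus if the Witt index is \<open>m\<close>, minus if it is \<open>m - 1\<close>.  Signs are the integers \<open>1\<close> and \<open>-1\<close>.
\<close>

definition has_type_on :: "(bit ^ 'm::finite \<Rightarrow> bit) \<Rightarrow> (bit ^ 'm) set \<Rightarrow> int \<Rightarrow> bool" where
  "has_type_on \<phi> U \<epsilon> \<longleftrightarrow>
     \<epsilon> = 1 \<and> vec.dim U = 2 * witt_index \<phi> U \<or>
     \<epsilon> = -1 \<and> vec.dim U = 2 * (witt_index \<phi> U + 1)"

definition quadratic_forms_of_type :: "'m::finite form \<Rightarrow> int \<Rightarrow> (bit ^ 'm \<Rightarrow> bit) set" where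
  "quadratic_forms_of_type B \<epsilon> = {\<phi> \<in> quadratic_forms B. has_type_on \<phi> UNIV \<epsilon>}"

definition form_action ::
    "'m::finite form \<Rightarrow> int \<Rightarrow> (bit ^ 'm \<Rightarrow> bit ^ 'm) \<Rightarrow> (bit ^ 'm \<Rightarrow> bit) \<Rightarrow> (bit ^ 'm \<Rightarrow> bit)" where
  "form_action B \<epsilon> g = (\<lambda>\<phi> \<in> quadratic_forms_of_type B \<epsilon>. \<lambda>x. \<phi> (inv_into UNIV g x))"

definition Delta_set ::
    "'m::finite form \<Rightarrow> int \<Rightarrow> int \<Rightarrow> (bit ^ 'm) set \<Rightarrow> (bit ^ 'm \<Rightarrow> bit) set" where
  "Delta_set B \<epsilon> \<epsilon>' U = {\<phi> \<in> quadratic_forms_of_type B \<epsilon>.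
     has_type_on \<phi> U \<epsilon>' \<and> has_type_on \<phi> (perp B U) (\<epsilon> * \<epsilon>')}"

text \<open>The parameter \<open>n\<close> is determined by \<open>B\<close>, a form on a space of dimension \<open>2 n\<close>.\<close>

definition Gamma_code :: "'m::finite form \<Rightarrow> nat \<Rightarrow> int \<Rightarrow> int \<Rightarrow> (bit ^ 'm \<Rightarrow> bit) set set" where
  "Gamma_code B d \<epsilon> \<epsilon>' = {Delta_set B \<epsilon> \<epsilon>' U | U.
     vec.subspace U \<and> nondegenerate_on B U \<and> vec.dim U = 2 * d}"


section \<open>The symplectic group acts on the forms of each type\<close>

lemma Sp_inv_closed:
  assumes "g \<in> carrier (Sp B)"
  shows "inv_into UNIV g \<in> carrier (Sp B)"
proof -
  have l: "Vector_Spaces.linear (*s) (*s) g" and b: "bij g"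
    and i: "\<And>x y. B (g x) (g y) = B x y" using assms by (auto simp: Sp_def)
  have "Vector_Spaces.linear (*s) (*s) (inv_into UNIV g)"
    unfolding Vector_Spaces.linear_iff
  proof (intro conjI allI vec.vector_space_axioms)
    have s: "g (inv_into UNIV g x) = x" and t: "inv_into UNIV g (g x) = x" for x
      using b by (simp_all add: bij_is_surj surj_f_inv_f bij_is_inj)
    show "inv_into UNIV g (x + y) = inv_into UNIV g x + inv_into UNIV g y" for x y
      using t[of "inv_into UNIV g x + inv_into UNIV g y"] by (simp add: vec.linear_add[OF l] s)
    show "inv_into UNIV g (c *s x) = c *s inv_into UNIV g x" for c x
      using t[of "c *s inv_into UNIV g x"] by (simp add: vec.linear_scale[OF l] s)
  qed
  moreover have "B (inv_into UNIV g x) (inv_into UNIV g y) = B x y" for x y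
    using i[of "inv_into UNIV g x" "inv_into UNIV g y"] b by (simp add: bij_is_surj surj_f_inv_f)
  ultimately show ?thesis using b by (simp add: Sp_def bij_imp_bij_inv)
qed

lemma group_Sp: "group (Sp B)"
proof (rule groupI)
  show "x \<otimes>\<^bsub>Sp B\<^esub> y \<in> carrier (Sp B)" if "x \<in> carrier (Sp B)" "y \<in> carrier (Sp B)" for x y
    using that by (auto simp: Sp_def bij_comp intro: Vector_Spaces.linear_compose)
  show "\<one>\<^bsub>Sp B\<^esub> \<in> carrier (Sp B)"
    by (auto simp: Sp_def vec.linear_id)
  show "\<exists>y\<in>carrier (Sp B). y \<otimes>\<^bsub>Sp B\<^esub> x = \<one>\<^bsub>Sp B\<^esub>" if "x \<in> carrier (Sp B)" for x
    using that Sp_inv_closed[OF that]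
    by (intro bexI[of _ "inv_into UNIV x"]) (auto simp: Sp_def bij_is_inj)
qed (auto simp: Sp_def)

lemma witt_index_compose:
  fixes g :: "bit ^ 'm::finite \<Rightarrow> bit ^ 'm"
  assumes l: "Vector_Spaces.linear (*s) (*s) g" and b: "bij g"
  shows "witt_index (\<lambda>x. \<phi> (g x)) UNIV = witt_index \<phi> UNIV"
proof -
  have d: "vec.dim (g ` W) = vec.dim W" for W
    using vec.dim_image_eq[OF l] b by (metis bij_is_inj inj_on_subset subset_UNIV)
  have "{vec.dim W | W. vec.subspace W \<and> W \<subseteq> UNIV \<and> (\<forall>w\<in>W. \<phi> (g w) = 0)}
      = {vec.dim W | W. vec.subspace W \<and> W \<subseteq> UNIV \<and> (\<forall>w\<in>W. \<phi> w = 0)}" (is "?L = ?R")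
  proof
    show "?L \<subseteq> ?R"
    proof
      fix k assume "k \<in> ?L"
      then obtain W where "vec.subspace W" "\<forall>w\<in>W. \<phi> (g w) = 0" "k = vec.dim W" by auto
      then show "k \<in> ?R"
        using vec.linear_subspace_image[OF l, of W] d[of W] by (auto intro!: exI[of _ "g ` W"])
    qed
    show "?R \<subseteq> ?L"
    proof
      fix k assume "k \<in> ?R"
      then obtain W where W: "vec.subspace W" "\<forall>w\<in>W. \<phi> w = 0" "k = vec.dim W" by auto
      have "g ` (g -` W) = W" using b by (simp add: bij_is_surj surj_image_vimage_eq)
      then show "k \<in> ?L"
        using W vec.linear_subspace_vimage[OF l, of W] d[of "g -` W"]
        by (auto intro!: exI[of _ "g -` W"])
    qed
  qed
  then show ?thesis by (simp add: witt_index_def)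
qed

lemma quadratic_forms_of_type_compose:
  assumes g: "g \<in> carrier (Sp B)" and \<phi>: "\<phi> \<in> quadratic_forms_of_type B \<epsilon>"
  shows "(\<lambda>x. \<phi> (g x)) \<in> quadratic_forms_of_type B \<epsilon>"
proof -
  have l: "Vector_Spaces.linear (*s) (*s) g" and b: "bij g"
    and i: "\<And>x y. B (g x) (g y) = B x y" using g by (auto simp: Sp_def)
  show ?thesis
    using \<phi> by (simp add: quadratic_forms_of_type_def quadratic_forms_def has_type_on_def
        witt_index_compose[OF l b] vec.linear_add[OF l] vec.linear_scale[OF l] i)
qed

lemma form_action_closed:
  assumes "g \<in> carrier (Sp B)" and "\<phi> \<in> quadratic_forms_of_type B \<epsilon>"
  shows "form_action B \<epsilon> g \<phi> \<in> quadratic_forms_of_type B \<epsilon>"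
  using quadratic_forms_of_type_compose[OF Sp_inv_closed[OF assms(1)] assms(2)] assms
  by (simp add: form_action_def)

lemma form_action_Bij:
  assumes g: "g \<in> carrier (Sp B)"
  shows "form_action B \<epsilon> g \<in> Bij (quadratic_forms_of_type B \<epsilon>)"
proof -
  have b: "bij g" using g by (simp add: Sp_def)
  have c: "(\<lambda>x. \<phi> (inv_into UNIV g x)) \<in> quadratic_forms_of_type B \<epsilon>"
    if "\<phi> \<in> quadratic_forms_of_type B \<epsilon>" for \<phi>
    using quadratic_forms_of_type_compose[OF Sp_inv_closed[OF g] that] .
  have "bij_betw (form_action B \<epsilon> g) (quadratic_forms_of_type B \<epsilon>) (quadratic_forms_of_type B \<epsilon>)"
    by (rule bij_betwI[where g = "\<lambda>\<phi> x. \<phi> (g x)"])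
       (use b c quadratic_forms_of_type_compose[OF g] in
         \<open>auto simp: form_action_def bij_is_inj bij_is_surj surj_f_inv_f\<close>)
  then show ?thesis by (auto simp: Bij_def form_action_def)
qed

lemma group_action_form_action:
  "group_action (Sp B) (quadratic_forms_of_type B \<epsilon>) (form_action B \<epsilon>)"
proof -
  have "form_action B \<epsilon> (g \<circ> h) = compose (quadratic_forms_of_type B \<epsilon>)
          (form_action B \<epsilon> g) (form_action B \<epsilon> h)"
    if "g \<in> carrier (Sp B)" "h \<in> carrier (Sp B)" for g h
  proof
    fix \<phi>
    have "bij g" "bij h" using that by (auto simp: Sp_def)
    then have "inv_into UNIV (g \<circ> h) = inv_into UNIV h \<circ> inv_into UNIV g" by (rule o_inv_distrib)
    then show "form_action B \<epsilon> (g \<circ> h) \<phi> = compose (quadratic_forms_of_type B \<epsilon>)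
          (form_action B \<epsilon> g) (form_action B \<epsilon> h) \<phi>"
      using form_action_closed[OF that(2), of \<phi> \<epsilon>]
      by (auto simp: form_action_def compose_def)
  qed
  then have "form_action B \<epsilon> \<in> hom (Sp B) (BijGroup (quadratic_forms_of_type B \<epsilon>))"
  proof (intro homI)
    fix g h assume gh: "g \<in> carrier (Sp B)" "h \<in> carrier (Sp B)"
      and *: "\<And>g h. g \<in> carrier (Sp B) \<Longrightarrow> h \<in> carrier (Sp B) \<Longrightarrow>
        form_action B \<epsilon> (g \<circ> h) = compose (quadratic_forms_of_type B \<epsilon>)
          (form_action B \<epsilon> g) (form_action B \<epsilon> h)"
    have "g \<otimes>\<^bsub>Sp B\<^esub> h = g \<circ> h" by (simp add: Sp_def)
    then show "form_action B \<epsilon> (g \<otimes>\<^bsub>Sp B\<^esub> h) =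
        form_action B \<epsilon> g \<otimes>\<^bsub>BijGroup (quadratic_forms_of_type B \<epsilon>)\<^esub> form_action B \<epsilon> h"
      using *[OF gh] form_action_Bij[OF gh(1), of \<epsilon>] form_action_Bij[OF gh(2), of \<epsilon>]
      by (simp add: BijGroup_def)
  qed (simp add: BijGroup_def form_action_Bij)
  then show ?thesis
    by (simp add: group_action_def group_hom_def group_hom_axioms_def group_Sp group_BijGroup)
qed

end

theory Submission
  imports Defs
begin

text \<open>
  For a quadratic form \<open>\<phi>\<close> and a subspace \<open>U\<close> let \<open>S \<phi> U\<close> be the sum of the signs \<open>(-1) ^ \<phi> u\<close> over
  \<open>u \<in> U\<close>. On a nondegenerate \<open>U\<close> of dimension \<open>2 m\<close> this sum is \<open>2 ^ m\<close> or \<open>- 2 ^ m\<close>, its sign is the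
  type of \<open>\<phi>\<close> on \<open>U\<close>, and it is multiplicative over the splitting of the space into \<open>U\<close> and its
  perpendicular space. The stabiliser of \<open>\<Delta>\<close> preserves \<open>U\<close>, hence also \<open>\<lambda>\<phi>. S \<phi> U\<close>, and it is transitive
  on \<open>\<Delta>\<close> and on the complement of \<open>\<Delta>\<close>; so \<open>S \<phi> U\<close> is constant on each of the two. Both values
  occur among the forms of type \<open>\<epsilon>\<close>, by counting the forms \<open>\<phi> + B c\<close> with \<open>c\<close> split along \<open>U\<close>.
  Therefore \<open>\<Delta>\<close> is a level set of \<open>S\<close>, and \<open>\<Gamma>\<close> is its orbit because nondegenerate subspaces of equal
  dimension are conjugate.
\<close>

section \<open>Vector spaces over the field with two elements\<close>

text \<open>Rewriting sums and products of bits into bitwise operations would block the ring laws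
  used below.\<close>

declare add_bit_eq_xor [simp del] mult_bit_eq_and [simp del]

instance bit :: finite
proof
  have "(UNIV :: bit set) \<subseteq> {0, 1}"
    using bit_not_zero_iff by auto
  then show "finite (UNIV :: bit set)" by (rule finite_subset) simp
qed

lemma bit_add_self [simp]: "a + a = (0 :: bit)"
  by (cases a) auto

lemma bit_vec_add_self [simp]: "x + x = (0 :: bit ^ 'm::finite)"
  by (simp add: vec_eq_iff)

lemma bit_vec_add_self_left [simp]: "x + (x + y) = (y :: bit ^ 'm::finite)"
  by (simp flip: add.assoc)

lemma bit_vec_add_eq_0_iff: "x + y = 0 \<longleftrightarrow> x = (y :: bit ^ 'm::finite)"
  by (metis bit_vec_add_self bit_vec_add_self_left add.right_neutral)

lemma bit_scale_cases: "c *s x = (if c = 0 then 0 else (x :: bit ^ 'm::finite))"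
  by (cases c) auto

lemma bit_subspaceI:
  fixes U :: "(bit ^ 'm::finite) set"
  assumes "0 \<in> U" and "\<And>x y. x \<in> U \<Longrightarrow> y \<in> U \<Longrightarrow> x + y \<in> U"
  shows "vec.subspace U"
  using assms by (auto simp: vec.subspace_def bit_scale_cases)

text \<open>A new vector \<open>a\<close> outside \<open>vec.span A\<close> adds just one further
  coset, disjoint from the span, so each basis vector doubles the cardinality.\<close>

lemma card_bit_span:
  fixes A :: "(bit ^ 'm::finite) set"
  assumes "vec.independent A"
  shows "card (vec.span A) = 2 ^ card A"
proof -
  have "finite A" by simp
  then show ?thesis using assms
  proof (induction A rule: finite_induct)
    case empty
    then show ?case by simp
  next
    case (insert a A)
    have ind: "vec.independent A" and na: "a \<notin> vec.span A"
      using insert.prems insert.hyps by (auto simp: vec.independent_insert)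
    have eq: "vec.span (insert a A) = vec.span A \<union> (+) a ` vec.span A"
    proof (intro subset_antisym subsetI)
      fix x assume "x \<in> vec.span (insert a A)"
      then obtain k where k: "x - k *s a \<in> vec.span A" by (auto simp: vec.span_insert)
      have "x - a \<in> vec.span A \<Longrightarrow> x \<in> (+) a ` vec.span A"
        by (rule image_eqI[of _ _ "x - a"]) auto
      then show "x \<in> vec.span A \<union> (+) a ` vec.span A"
        using k by (auto simp: bit_scale_cases split: if_splits)
    next
      fix x assume "x \<in> vec.span A \<union> (+) a ` vec.span A"
      then show "x \<in> vec.span (insert a A)"
        using vec.span_mono[of A "insert a A"] vec.span_base[of a "insert a A"]
        by (auto intro!: vec.span_add)
    qed
    have "vec.span A \<inter> (+) a ` vec.span A = {}"
      using na by (auto dest: vec.span_diff)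
    then have "card (vec.span (insert a A)) = 2 * card (vec.span A)"
      unfolding eq by (subst card_Un_disjoint) (auto simp: card_image)
    then show ?case using insert.IH[OF ind] insert.hyps by simp
  qed
qed

lemma card_bit_subspace:
  fixes U :: "(bit ^ 'm::finite) set"
  assumes "vec.subspace U"
  shows "card U = 2 ^ vec.dim U"
proof -
  obtain A where "A \<subseteq> U" "vec.independent A" "U \<subseteq> vec.span A" "card A = vec.dim U"
    using vec.basis_exists by blast
  moreover from this assms have "vec.span A = U"
    by (metis subset_antisym vec.span_minimal)
  ultimately show ?thesis using card_bit_span by metis
qed

lemma sum_subspace_translate:
  fixes U :: "(bit ^ 'm::finite) set"
  assumes "vec.subspace U" and "a \<in> U"
  shows "(\<Sum>u\<in>U. f (u + a)) = (\<Sum>u\<in>U. f u)"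
  by (rule sum.reindex_bij_witness[of _ "\<lambda>u. u + a" "\<lambda>u. u + a"])
     (use assms in \<open>auto simp: add.assoc vec.subspace_add\<close>)


section \<open>Sign sums of quadratic forms\<close>

text \<open>The nontrivial additive character of the field, with integer values.\<close>

definition bit_sign :: "bit \<Rightarrow> int" where
  "bit_sign b = (if b = 0 then 1 else -1)"

lemma bit_sign_0 [simp]: "bit_sign 0 = 1" and bit_sign_1 [simp]: "bit_sign 1 = -1"
  by (simp_all add: bit_sign_def)

lemma bit_sign_add: "bit_sign (a + b) = bit_sign a * bit_sign b"
  by (cases a; cases b) auto

lemma bit_sign_mult_self [simp]: "bit_sign a * bit_sign a = 1"
  by (cases a) auto

text \<open>The number of zeros of \<open>\<phi>\<close> in \<open>U\<close> minus the number of
  nonzeros; for a quadratic form it is a Gauss sum.\<close>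

definition sign_sum :: "(bit ^ 'm::finite \<Rightarrow> bit) \<Rightarrow> (bit ^ 'm) set \<Rightarrow> int" where
  "sign_sum \<phi> U = (\<Sum>u\<in>U. bit_sign (\<phi> u))"

text \<open>For signs \<open>s\<close> and \<open>t\<close> the indicator of \<open>t = s\<close> is
  half of \<open>1 + s * t\<close>; it is summed over \<open>U\<close>.\<close>

lemma card_bit_sign_eq:
  assumes "finite U" and "s \<in> {1, -1}"
  shows "2 * int (card {u \<in> U. bit_sign (\<phi> u) = s}) = int (card U) + s * sign_sum \<phi> U"
proof -
  have "int (card {u \<in> U. bit_sign (\<phi> u) = s}) = (\<Sum>u\<in>U. if bit_sign (\<phi> u) = s then 1 else 0)"
    using assms(1) by (simp add: sum.If_cases Int_def)
  then have "2 * int (card {u \<in> U. bit_sign (\<phi> u) = s})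
      = (\<Sum>u\<in>U. 2 * (if bit_sign (\<phi> u) = s then 1 else 0))"
    by (simp add: sum_distrib_left)
  also have "\<dots> = (\<Sum>u\<in>U. 1 + s * bit_sign (\<phi> u))"
    using assms(2) by (intro sum.cong) (auto simp: bit_sign_def)
  finally show ?thesis by (simp add: sum.distrib sign_sum_def sum_distrib_left)
qed

text \<open>Translation by \<open>a\<close> permutes \<open>U\<close> and flips every sign, so the
  sum equals its own negative.\<close>

lemma sum_bit_sign_additive:
  fixes f :: "bit ^ 'm::finite \<Rightarrow> bit"
  assumes U: "vec.subspace U" and add: "\<And>x y. f (x + y) = f x + f y" and a: "a \<in> U" "f a = 1"
  shows "(\<Sum>u\<in>U. bit_sign (f u)) = 0"
proof -
  have "(\<Sum>u\<in>U. bit_sign (f u)) = (\<Sum>u\<in>U. bit_sign (f (u + a)))"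
    using sum_subspace_translate[OF U a(1), of "\<lambda>u. bit_sign (f u)"] by simp
  also have "\<dots> = - (\<Sum>u\<in>U. bit_sign (f u))"
    by (simp add: add bit_sign_add a sum_negf)
  finally show ?thesis by simp
qed

section \<open>Bilinear calculus of a symplectic form\<close>

locale symplectic =
  fixes B :: "bit ^ 'm::finite \<Rightarrow> bit ^ 'm \<Rightarrow> bit"
  assumes symplectic: "symplectic_form B"
begin

lemma add_right: "B x (y + z) = B x y + B x z"
  using symplectic vec.linear_add by (auto simp: symplectic_form_def Vector_Spaces.linear_iff)

lemma add_left: "B (x + y) z = B x z + B y z"
  using symplectic by (auto simp: symplectic_form_def Vector_Spaces.linear_iff)

lemma self [simp]: "B x x = 0"
  using symplectic by (auto simp: symplectic_form_def)

lemma zero_left [simp]: "B 0 x = 0" and zero_right [simp]: "B x 0 = 0"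
  using add_left[of 0 0 x] add_right[of x 0 0] by auto

lemma commute: "B x y = B y x"
proof -
  have "B (x + y) (x + y) = B x y + B y x" by (simp only: add_left add_right) simp
  then show ?thesis by (cases "B x y"; cases "B y x") auto
qed

lemma scale_left: "B (c *s x) y = c * B x y" and scale_right: "B x (c *s y) = c * B x y"
  by (auto simp: bit_scale_cases)

lemma nondegenerate_UNIV: "nondegenerate_on B UNIV"
  using symplectic by (auto simp: symplectic_form_def)

lemma subspace_perp: "vec.subspace (perp B U)"
  by (rule bit_subspaceI) (auto simp: perp_def add_right)

text \<open>Orthogonality of characters: \<open>B x\<close> induces a character of \<open>U\<close>,
  which is either trivial or sums to zero.\<close>

lemma sum_bit_sign:
  assumes "vec.subspace U"
  shows "(\<Sum>u\<in>U. bit_sign (B x u)) = (if x \<in> perp B U then int (card U) else 0)"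
proof (cases "x \<in> perp B U")
  case True
  then have "\<And>u. u \<in> U \<Longrightarrow> B x u = 0" by (auto simp: perp_def commute)
  then show ?thesis using True by simp
next
  case False
  then obtain a where a: "a \<in> U" "B x a = 1" by (auto simp: perp_def commute)
  show ?thesis
    using False sum_bit_sign_additive[of U "B x", OF assms _ a] by (simp add: add_right)
qed

text \<open>Sum \<open>bit_sign (B x w)\<close> over \<open>U\<close> and \<open>W\<close> in two
  orders. Summing over \<open>W\<close> first leaves the \<open>x\<close> in
  \<open>perp B W\<close>; summing over \<open>U\<close> first leaves only \<open>w = 0\<close>,
  because \<open>U\<close> is nondegenerate.\<close>

lemma card_perp:
  assumes U: "vec.subspace U" "nondegenerate_on B U" and W: "vec.subspace W" "W \<subseteq> U"
  shows "card W * card (U \<inter> perp B W) = card U"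
proof -
  have "int (card W * card (U \<inter> perp B W)) = (\<Sum>x\<in>U. if x \<in> perp B W then int (card W) else 0)"
    by (simp add: sum.If_cases)
  also have "\<dots> = (\<Sum>x\<in>U. \<Sum>w\<in>W. bit_sign (B x w))"
    using sum_bit_sign[OF W(1)] by simp
  also have "\<dots> = (\<Sum>w\<in>W. \<Sum>x\<in>U. bit_sign (B w x))"
    by (subst sum.swap) (simp add: commute)
  also have "\<dots> = (\<Sum>w\<in>W. if w \<in> perp B U then int (card U) else 0)"
    using sum_bit_sign[OF U(1)] by simp
  also have "\<dots> = (\<Sum>w\<in>W. if w = 0 then int (card U) else 0)"
    using U(2) W(2) by (intro sum.cong) (auto simp: nondegenerate_on_def perp_def)
  also have "\<dots> = int (card U)"
    using vec.subspace_0[OF W(1)] by simp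
  finally show ?thesis by linarith
qed

section \<open>Quadratic forms on nondegenerate subspaces\<close>

lemma quadratic_add:
  assumes "\<phi> \<in> quadratic_forms B"
  shows "\<phi> (x + y) = \<phi> x + \<phi> y + B x y"
proof -
  have "\<phi> (x + y) + \<phi> x + \<phi> y = B x y" using assms by (auto simp: quadratic_forms_def)
  then show ?thesis by (cases "\<phi> x"; cases "\<phi> y"; cases "\<phi> (x + y)"; cases "B x y") auto
qed

lemma quadratic_0:
  assumes "\<phi> \<in> quadratic_forms B"
  shows "\<phi> 0 = 0"
  using quadratic_add[OF assms, of 0 0] by (cases "\<phi> 0") auto

text \<open>The usual evaluation of a Gauss sum: \<open>y = z + x\<close> turns
  \<open>\<phi> x + \<phi> y\<close> into \<open>\<phi> z + B z x\<close>, and summing over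
  \<open>x\<close> removes every \<open>z\<close> except 0.\<close>

lemma sign_sum_square:
  assumes U: "vec.subspace U" "nondegenerate_on B U" and \<phi>: "\<phi> \<in> quadratic_forms B"
  shows "(sign_sum \<phi> U)\<^sup>2 = int (card U)"
proof -
  have "(sign_sum \<phi> U)\<^sup>2 = (\<Sum>x\<in>U. \<Sum>y\<in>U. bit_sign (\<phi> x) * bit_sign (\<phi> y))"
    by (simp add: sign_sum_def power2_eq_square sum_product)
  also have "\<dots> = (\<Sum>x\<in>U. \<Sum>z\<in>U. bit_sign (\<phi> x) * bit_sign (\<phi> (z + x)))"
    by (intro sum.cong refl sum_subspace_translate[OF U(1), symmetric])
  also have "\<dots> = (\<Sum>x\<in>U. \<Sum>z\<in>U. bit_sign (\<phi> z) * bit_sign (B z x))"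
    by (intro sum.cong refl) (simp add: quadratic_add[OF \<phi>] bit_sign_add)
  also have "\<dots> = (\<Sum>z\<in>U. bit_sign (\<phi> z) * (\<Sum>x\<in>U. bit_sign (B z x)))"
    by (subst sum.swap) (simp add: sum_distrib_left)
  also have "\<dots> = (\<Sum>z\<in>U. if z = 0 then int (card U) else 0)"
    using U(2) quadratic_0[OF \<phi>]
    by (intro sum.cong) (auto simp: sum_bit_sign[OF U(1)] nondegenerate_on_def perp_def)
  finally show ?thesis using vec.subspace_0[OF U(1)] by simp
qed

text \<open>Averaging over translations by \<open>W\<close> weights each \<open>x\<close> by the
  character sum of \<open>B x\<close> on \<open>W\<close>, which vanishes unless \<open>x\<close> is
  orthogonal to \<open>W\<close>.\<close>

lemma sign_sum_singular_subspace:
  assumes U: "vec.subspace U" and W: "vec.subspace W" "W \<subseteq> U" and \<phi>: "\<phi> \<in> quadratic_forms B"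
    and sing: "\<And>w. w \<in> W \<Longrightarrow> \<phi> w = 0"
  shows "sign_sum \<phi> U = sign_sum \<phi> (U \<inter> perp B W)"
proof -
  have "int (card W) * sign_sum \<phi> U = (\<Sum>w\<in>W. \<Sum>x\<in>U. bit_sign (\<phi> (x + w)))"
  proof -
    have "(\<Sum>x\<in>U. bit_sign (\<phi> (x + w))) = sign_sum \<phi> U" if "w \<in> W" for w
      unfolding sign_sum_def
      using that W(2) by (intro sum_subspace_translate[OF U, of w "\<lambda>x. bit_sign (\<phi> x)"]) auto
    then show ?thesis by simp
  qed
  also have "\<dots> = (\<Sum>x\<in>U. bit_sign (\<phi> x) * (\<Sum>w\<in>W. bit_sign (B x w)))"
    by (subst sum.swap) (simp add: quadratic_add[OF \<phi>] sing bit_sign_add sum_distrib_left)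
  also have "\<dots> = (\<Sum>x\<in>U. if x \<in> perp B W then int (card W) * bit_sign (\<phi> x) else 0)"
    by (intro sum.cong) (auto simp: sum_bit_sign[OF W(1)])
  also have "\<dots> = int (card W) * sign_sum \<phi> (U \<inter> perp B W)"
    by (simp add: sum.If_cases sign_sum_def sum_distrib_left)
  finally show ?thesis using card_bit_subspace[OF W(1)] by simp
qed

text \<open>Take a totally singular \<open>W\<close> of largest dimension. Only
  \<open>U \<inter> perp B W\<close> contributes to the sum, and there \<open>\<phi>\<close>
  vanishes exactly on \<open>W\<close>. This expresses the sum through the Witt index, and its known
  square leaves two possible indices, one for each sign.\<close>

lemma has_type_on_iff_sign_sum:
  assumes U: "vec.subspace U" "nondegenerate_on B U" "vec.dim U = 2 * m"
    and \<phi>: "\<phi> \<in> quadratic_forms B" and e: "e \<in> {1, -1}"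
  shows "has_type_on \<phi> U e \<longleftrightarrow> sign_sum \<phi> U = e * 2 ^ m"
proof -
  define D where "D = {vec.dim W | W. vec.subspace W \<and> W \<subseteq> U \<and> (\<forall>w \<in> W. \<phi> w = 0)}"
  have fin: "finite D"
    by (rule finite_subset[of _ "vec.dim ` (UNIV :: (bit ^ 'm) set set)"]) (auto simp: D_def)
  have "vec.dim {0 :: bit ^ 'm} \<in> D"
    using quadratic_0[OF \<phi>] vec.subspace_0[OF U(1)] unfolding D_def
    by (intro CollectI exI[of _ "{0}"]) (auto intro: bit_subspaceI)
  then have "Max D \<in> D" using fin by (intro Max_in) auto
  then obtain W where W: "vec.subspace W" "W \<subseteq> U" and sing: "\<And>w. w \<in> W \<Longrightarrow> \<phi> w = 0"
    and dW: "vec.dim W = Max D" by (auto simp: D_def)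
  define w where "w = Max D"
  have wi: "witt_index \<phi> U = w" by (simp add: witt_index_def D_def w_def)
  have cW: "card W = 2 ^ w" using card_bit_subspace[OF W(1)] dW w_def by simp
  \<comment> \<open>Polarisation: a totally singular subspace is totally isotropic.\<close>
  have Wperp: "W \<subseteq> U \<inter> perp B W"
  proof
    fix x assume x: "x \<in> W"
    have "B y x = 0" if y: "y \<in> W" for y
      using quadratic_add[OF \<phi>, of y x] sing x y vec.subspace_add[OF W(1) y x] by simp
    then show "x \<in> U \<inter> perp B W" using x W(2) by (auto simp: perp_def)
  qed
  \<comment> \<open>A further singular vector \<open>x\<close> orthogonal to \<open>W\<close> would
    extend \<open>W\<close> to the totally singular subspace \<open>?W\<close>, against
    maximality.\<close>
  have anis: "\<phi> x = 1" if x: "x \<in> U \<inter> perp B W" "x \<notin> W" for x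
  proof (rule ccontr)
    assume "\<phi> x \<noteq> 1"
    then have x0: "\<phi> x = 0" by simp
    let ?W = "W \<union> (+) x ` W"
    have sub: "vec.subspace ?W"
    proof (rule bit_subspaceI)
      show "0 \<in> ?W" using vec.subspace_0[OF W(1)] by simp
      have "x + a + (x + b) = a + b" for a b
        by (metis add.assoc add.commute bit_vec_add_self_left)
      then show "a + b \<in> ?W" if "a \<in> ?W" "b \<in> ?W" for a b
        using that vec.subspace_add[OF W(1)] by (auto simp: add.assoc add.left_commute)
    qed
    have UW: "?W \<subseteq> U" using W(2) x(1) vec.subspace_add[OF U(1)] by auto
    have sW: "\<forall>w \<in> ?W. \<phi> w = 0"
      using x(1) sing by (auto simp: quadratic_add[OF \<phi>] x0 perp_def commute)
    have "vec.dim ?W \<le> w"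
      unfolding w_def using fin sub UW sW unfolding D_def by (intro Max_ge) blast+
    then have "card ?W \<le> card W" using cW card_bit_subspace[OF sub] by simp
    moreover have "x \<in> ?W" using vec.subspace_0[OF W(1)] by (auto intro!: image_eqI[of _ _ 0])
    ultimately show False using x(2)
      by (metis Un_upper1 card_seteq finite)
  qed
  have cp: "2 ^ w * card (U \<inter> perp B W) = 2 ^ (2 * m)"
    using card_perp[OF U(1,2) W] cW card_bit_subspace[OF U(1)] U(3) by simp
  have "card W \<le> card (U \<inter> perp B W)" using Wperp by (simp add: card_mono)
  then have "(2::nat) ^ w * 2 ^ w \<le> 2 ^ (2 * m)"
    unfolding cp[symmetric] cW by simp
  then have "w \<le> m" by (simp flip: power_add add: mult_2)
  \<comment> \<open>The defect of the Witt index from half the dimension; the aim is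
    \<open>t = 0\<close> or \<open>t = 1\<close>.\<close>
  then obtain t where t: "m = w + t" using le_Suc_ex by blast
  have "2 ^ w * card (U \<inter> perp B W) = 2 ^ w * 2 ^ (w + 2 * t)"
    using cp by (simp add: t flip: power_add)
  then have cp': "card (U \<inter> perp B W) = 2 ^ (w + 2 * t)" by simp
  have "sign_sum \<phi> U = sign_sum \<phi> (U \<inter> perp B W)"
    using sing by (rule sign_sum_singular_subspace[OF U(1) W \<phi>])
  also have "\<dots> = (\<Sum>x\<in>U \<inter> perp B W. if x \<in> W then 1 else -1)"
    unfolding sign_sum_def
  proof (intro sum.cong refl)
    show "bit_sign (\<phi> x) = (if x \<in> W then 1 else -1)" if "x \<in> U \<inter> perp B W" for x
      using sing[of x] anis[OF that] by simp
  qed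
  also have "\<dots> = int (card W) - int (card (U \<inter> perp B W - W))"
    using Wperp by (simp add: sum.If_cases Int_absorb1 flip: Diff_eq)
  also have "int (card (U \<inter> perp B W - W)) = int (card (U \<inter> perp B W)) - int (card W)"
    using Wperp by (simp add: card_Diff_subset card_mono of_nat_diff)
  finally have "sign_sum \<phi> U = 2 ^ w - (2 ^ (w + 2 * t) - 2 ^ w)"
    by (simp add: cW cp')
  moreover have "(2::int) ^ (w + 2 * t) = 2 ^ w * (2 ^ t * 2 ^ t)"
    by (simp only: power_add mult_2)
  ultimately have S: "sign_sum \<phi> U = 2 ^ w * (2 - 2 ^ t * 2 ^ t)"
    by (simp add: right_diff_distrib)
  have "(sign_sum \<phi> U)\<^sup>2 = int (2 ^ (2 * m))"
    using sign_sum_square[OF U(1,2) \<phi>] card_bit_subspace[OF U(1)] U(3) by simp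
  then have "(2 ^ w)\<^sup>2 * (2 - 2 ^ t * 2 ^ t)\<^sup>2 = (2 ^ w)\<^sup>2 * (2 ^ t * 2 ^ t :: int)"
    using S t by (simp add: power_mult_distrib power_add power_mult[of _ 2] power2_eq_square
        mult.commute[of 2] power_mult mult_ac)
  then have "(2 - 2 ^ t * 2 ^ t)\<^sup>2 = (2 ^ t * 2 ^ t :: int)" by simp
  \<comment> \<open>With \<open>q = 2 ^ t * 2 ^ t\<close>, the equation
    \<open>(2 - q)\<^sup>2 = q\<close> factors, with roots 1 and 4.\<close>
  then have "((2 ^ t) * (2 ^ t) - 1) * ((2 ^ t) * (2 ^ t) - 4) = (0 :: int)"
    by (simp add: power2_eq_square algebra_simps)
  then have "(2::int) ^ (t + t) = 2 ^ 0 \<or> (2::int) ^ (t + t) = 2 ^ 2"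
    unfolding power_add by auto
  then have "t + t = 0 \<or> t + t = 2"
    by (metis power_inject_exp one_less_numeral_iff semiring_norm(76))
  then have "t = 0 \<or> t = 1" by linarith
  then show ?thesis
    using e U(3) by (auto simp: has_type_on_def wi S t)
qed

lemma sign_sum_cases:
  assumes U: "vec.subspace U" "nondegenerate_on B U" "vec.dim U = 2 * m"
    and \<phi>: "\<phi> \<in> quadratic_forms B"
  obtains e where "e \<in> {1, -1}" and "sign_sum \<phi> U = e * 2 ^ m"
proof -
  have "(sign_sum \<phi> U)\<^sup>2 = (2 ^ m)\<^sup>2"
    using sign_sum_square[OF U(1,2) \<phi>] card_bit_subspace[OF U(1)] U(3)
    by (simp add: power_mult power2_eq_square flip: power_mult_distrib)
  then show ?thesis using that[of 1] that[of "-1"] by (auto simp: power2_eq_iff)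
qed


section \<open>Orthogonal decompositions\<close>

text \<open>Uniqueness of the splitting comes from \<open>U \<inter> perp B U = {0}\<close>,
  existence from the count \<open>card_perp\<close> in the whole space.\<close>

lemma bij_betw_perp:
  assumes U: "vec.subspace U" "nondegenerate_on B U"
  shows "bij_betw (\<lambda>(u, v). u + v) (U \<times> perp B U) UNIV"
proof -
  have inj: "inj_on (\<lambda>(u, v). u + v) (U \<times> perp B U)"
  proof (rule inj_onI, clarify)
    fix u v u' v' assume *: "u \<in> U" "v \<in> perp B U" "u' \<in> U" "v' \<in> perp B U" "u + v = u' + v'"
    have "u + u' = v + v'"
      using *(5) by (metis add.assoc add.commute bit_vec_add_self_left)
    then have "u + u' \<in> U \<inter> perp B U"
      using * vec.subspace_add[OF U(1), of u u'] vec.subspace_add[OF subspace_perp, of v U v'] by auto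
    then have "u + u' = 0" using U(2) by (auto simp: nondegenerate_on_def)
    then show "u = u' \<and> v = v'" using *(5) by (auto simp: bit_vec_add_eq_0_iff)
  qed
  have "card ((\<lambda>(u, v). u + v) ` (U \<times> perp B U)) = card (UNIV :: (bit ^ 'm) set)"
    using card_perp[OF vec.subspace_UNIV nondegenerate_UNIV U(1)]
    by (simp only: card_image[OF inj]) (simp add: card_cartesian_product)
  then have "(\<lambda>(u, v). u + v) ` (U \<times> perp B U) = UNIV"
    by (intro card_subset_eq) auto
  then show ?thesis using inj by (simp add: bij_betw_def)
qed

lemma perp_decompose:
  assumes "vec.subspace U" "nondegenerate_on B U"
  obtains u v where "u \<in> U" "v \<in> perp B U" "x = u + v"
  using bij_betw_imp_surj_on[OF bij_betw_perp[OF assms]]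
  by (smt (verit) UNIV_I imageE mem_Sigma_iff old.prod.case surj_pair)

text \<open>\<open>U\<close> and \<open>perp B U\<close> span the space, so a vector orthogonal to
  both lies in the radical of \<open>B\<close>.\<close>

lemma nondegenerate_perp:
  assumes U: "vec.subspace U" "nondegenerate_on B U"
  shows "nondegenerate_on B (perp B U)"
proof -
  have "x = 0" if x: "x \<in> perp B U" "x \<in> perp B (perp B U)" for x
  proof -
    have "B y x = 0" for y
    proof -
      obtain u v where "u \<in> U" "v \<in> perp B U" "y = u + v" by (rule perp_decompose[OF U])
      then show ?thesis using x by (auto simp: perp_def add_left)
    qed
    then show ?thesis using nondegenerate_UNIV by (auto simp: nondegenerate_on_def perp_def)
  qed
  then show ?thesis
    using vec.subspace_0[OF subspace_perp] by (auto simp: nondegenerate_on_def)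
qed

lemma dim_perp:
  assumes U: "vec.subspace U" "nondegenerate_on B U"
  shows "vec.dim U + vec.dim (perp B U) = CARD('m)"
proof -
  have "(2::nat) ^ (vec.dim U + vec.dim (perp B U)) = 2 ^ vec.dim (UNIV :: (bit ^ 'm) set)"
    using card_perp[OF vec.subspace_UNIV nondegenerate_UNIV U(1)]
    by (simp add: card_bit_subspace[OF U(1)] card_bit_subspace[OF subspace_perp]
        power_add card_bit_subspace[OF vec.subspace_UNIV] del: CARD_vec)
  then have "vec.dim U + vec.dim (perp B U) = vec.dim (UNIV :: (bit ^ 'm) set)"
    by (simp only: power_inject_exp)
  then show ?thesis by (simp add: vec.dim_UNIV card_cart_basis)
qed

text \<open>The cross term \<open>B u v\<close> vanishes for \<open>u\<close> in \<open>U\<close>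
  and \<open>v\<close> in \<open>perp B U\<close>, so the sign of \<open>\<phi> (u + v)\<close>
  factors.\<close>

lemma sign_sum_perp:
  assumes U: "vec.subspace U" "nondegenerate_on B U" and \<phi>: "\<phi> \<in> quadratic_forms B"
  shows "sign_sum \<phi> UNIV = sign_sum \<phi> U * sign_sum \<phi> (perp B U)"
proof -
  have "sign_sum \<phi> UNIV = (\<Sum>(u, v)\<in>U \<times> perp B U. bit_sign (\<phi> (u + v)))"
    unfolding sign_sum_def
    using sum.reindex_bij_betw[OF bij_betw_perp[OF U], of "\<lambda>x. bit_sign (\<phi> x)"]
    by (simp add: case_prod_unfold)
  also have "\<dots> = (\<Sum>(u, v)\<in>U \<times> perp B U. bit_sign (\<phi> u) * bit_sign (\<phi> v))"
    by (intro sum.cong) (auto simp: quadratic_add[OF \<phi>] bit_sign_add perp_def)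
  finally show ?thesis by (simp add: sign_sum_def sum_product sum.cartesian_product)
qed


section \<open>Counting quadratic forms\<close>

lemma quadratic_shift:
  assumes \<phi>: "\<phi> \<in> quadratic_forms B"
  shows "(\<lambda>x. \<phi> x + B c x) \<in> quadratic_forms B"
proof -
  have "\<phi> (a *s x) + B c (a *s x) = a\<^sup>2 * (\<phi> x + B c x)" for a x
    by (cases a) (auto simp: quadratic_0[OF \<phi>])
  moreover have "\<phi> (x + y) + B c (x + y) + (\<phi> x + B c x) + (\<phi> y + B c y) = B x y" for x y
    unfolding quadratic_add[OF \<phi>] add_right
    by (cases "\<phi> x"; cases "\<phi> y"; cases "B c x"; cases "B c y"; cases "B x y"; simp)
  ultimately show ?thesis by (auto simp: quadratic_forms_def)
qed

text \<open>Fourier argument: the character sums of \<open>f x + B c x\<close>, added over all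
  \<open>c\<close>, give the size of the space, so some \<open>c\<close> has a nonzero sum. An
  additive function with nonzero character sum is zero, whence \<open>f = B c\<close>.\<close>

lemma additive_functional_represented:
  assumes add: "\<And>x y. f (x + y) = f x + f y"
  obtains c where "f = B c"
proof -
  have f0: "f 0 = 0" using add[of 0 0] by simp
  have "(\<Sum>c\<in>UNIV. \<Sum>x\<in>UNIV. bit_sign (f x + B c x))
      = (\<Sum>x\<in>UNIV. bit_sign (f x) * (\<Sum>c\<in>UNIV. bit_sign (B x c)))"
    by (subst sum.swap) (simp add: bit_sign_add sum_distrib_left commute)
  also have "\<dots> = (\<Sum>x::bit ^ 'm\<in>UNIV. if x = 0 then int CARD(bit ^ 'm) else 0)"
    using nondegenerate_UNIV
    by (intro sum.cong refl)
       (auto simp: sum_bit_sign[OF vec.subspace_UNIV] f0 nondegenerate_on_def perp_def simp del: CARD_vec)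
  also have "\<dots> \<noteq> 0" by simp
  finally obtain c where c: "(\<Sum>x\<in>UNIV. bit_sign (f x + B c x)) \<noteq> 0"
    by (metis (no_types, lifting) sum.neutral)
  have "f x + B c x \<noteq> 1" for x
  proof
    assume "f x + B c x = 1"
    then have "(\<Sum>x\<in>UNIV. bit_sign (f x + B c x)) = 0"
      by (intro sum_bit_sign_additive[OF vec.subspace_UNIV, of _ x])
         (simp_all add: add add_right add_ac)
    then show False using c by contradiction
  qed
  then have "f x = B c x" for x
    by (cases "f x"; cases "B c x") (metis add_0 add.right_neutral)+
  then show ?thesis using that by blast
qed

text \<open>Two forms with polarisation \<open>B\<close> differ by an additive function, hence by
  some \<open>B c\<close>, and \<open>c\<close> is unique by nondegeneracy.\<close>

lemma bij_betw_quadratic_shift: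
  assumes \<phi>: "\<phi> \<in> quadratic_forms B"
  shows "bij_betw (\<lambda>c x. \<phi> x + B c x) UNIV (quadratic_forms B)"
proof -
  have "inj (\<lambda>c x. \<phi> x + B c x)"
  proof (rule injI)
    fix c c' assume "(\<lambda>x. \<phi> x + B c x) = (\<lambda>x. \<phi> x + B c' x)"
    then have "B c x = B c' x" for x by (metis add_left_cancel)
    then have "c + c' \<in> UNIV \<inter> perp B UNIV" by (auto simp: perp_def commute[of _ "c + c'"] add_left)
    then show "c = c'" using nondegenerate_UNIV by (simp add: nondegenerate_on_def bit_vec_add_eq_0_iff)
  qed
  moreover have "\<psi> \<in> range (\<lambda>c x. \<phi> x + B c x)" if \<psi>: "\<psi> \<in> quadratic_forms B" for \<psi>
  proof -
    have "\<psi> (x + y) + \<phi> (x + y) = (\<psi> x + \<phi> x) + (\<psi> y + \<phi> y)" for x y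
      unfolding quadratic_add[OF \<phi>] quadratic_add[OF \<psi>]
      by (cases "B x y") (simp_all add: ac_simps)
    then obtain c where c: "(\<lambda>x. \<psi> x + \<phi> x) = B c"
      using additive_functional_represented[of "\<lambda>x. \<psi> x + \<phi> x"] by blast
    have "\<psi> x = \<phi> x + B c x" for x
      unfolding c[symmetric] by (cases "\<phi> x") (simp_all add: ac_simps)
    then show ?thesis by (intro image_eqI[of _ _ c]) auto
  qed
  ultimately show ?thesis using quadratic_shift[OF \<phi>] by (auto simp: bij_betw_def)
qed

text \<open>Completing the square: \<open>\<phi> x + B u x = \<phi> (x + u) + \<phi> u\<close>,
  while \<open>B v\<close> vanishes on \<open>U\<close>. Translation by \<open>u\<close> leaves only
  the sign of \<open>\<phi> u\<close>.\<close>

lemma sign_sum_shift: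
  assumes U: "vec.subspace U" and \<phi>: "\<phi> \<in> quadratic_forms B"
    and u: "u \<in> U" and v: "v \<in> perp B U"
  shows "sign_sum (\<lambda>x. \<phi> x + B (u + v) x) U = bit_sign (\<phi> u) * sign_sum \<phi> U"
proof -
  have "bit_sign (\<phi> x + B (u + v) x) = bit_sign (\<phi> u) * bit_sign (\<phi> (x + u))" if "x \<in> U" for x
    using v that
    by (cases "\<phi> u")
       (auto simp: perp_def commute[of _ x] add_right quadratic_add[OF \<phi>] bit_sign_add)
  then have "sign_sum (\<lambda>x. \<phi> x + B (u + v) x) U = (\<Sum>x\<in>U. bit_sign (\<phi> u) * bit_sign (\<phi> (x + u)))"
    by (simp add: sign_sum_def)
  also have "\<dots> = bit_sign (\<phi> u) * sign_sum \<phi> U"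
    using sum_subspace_translate[OF U u, of "\<lambda>x. bit_sign (\<phi> x)"]
    by (simp add: sign_sum_def flip: sum_distrib_left)
  finally show ?thesis .
qed

text \<open>Fix one form \<open>\<phi>\<close> and write every form as its shift by
  \<open>u + v\<close> along the splitting. The two sign sums are multiplied by the signs of
  \<open>\<phi> u\<close> and \<open>\<phi> v\<close> separately, so the forms counted correspond to
  a product \<open>M \<times> N\<close>.\<close>

lemma card_sign_sum_pair:
  assumes U: "vec.subspace U" "nondegenerate_on B U" "vec.dim U = 2 * d"
    and n: "CARD('m) = 2 * n" "n \<ge> 2" "d \<le> n"
    and ne: "quadratic_forms B \<noteq> {}" and e: "e \<in> {1, -1}" "e' \<in> {1, -1}"
  shows "int (card {\<phi> \<in> quadratic_forms B. sign_sum \<phi> U = e * 2 ^ d \<and>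
           sign_sum \<phi> (perp B U) = e' * 2 ^ (n - d)})
         = 2 ^ (n - 2) * (2 ^ d + e) * (2 ^ (n - d) + e')" (is "int (card ?D) = _")
proof -
  obtain \<phi> where \<phi>: "\<phi> \<in> quadratic_forms B" using ne by blast
  let ?P = "perp B U"
  note P = subspace_perp[of U] nondegenerate_perp[OF U(1,2)]
  have dP: "vec.dim ?P = 2 * (n - d)" using dim_perp[OF U(1,2)] n U(3) by simp
  obtain a where a: "a \<in> {1, -1}" "sign_sum \<phi> U = a * 2 ^ d" by (rule sign_sum_cases[OF U \<phi>])
  obtain b where b: "b \<in> {1, -1}" "sign_sum \<phi> ?P = b * 2 ^ (n - d)"
    by (rule sign_sum_cases[OF P dP \<phi>])
  let ?f = "\<lambda>(u, v) x. \<phi> x + B (u + v) x"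
  \<comment> \<open>A sign is its own inverse, so \<open>e * a\<close> is the factor taking the sign
    \<open>a\<close> of \<open>\<phi>\<close> on \<open>U\<close> to the wanted \<open>e\<close>;
    likewise for \<open>N\<close> on \<open>?P\<close>.\<close>
  define M where "M = {u \<in> U. bit_sign (\<phi> u) = e * a}"
  define N where "N = {v \<in> ?P. bit_sign (\<phi> v) = e' * b}"
  have "bij_betw ((\<lambda>c x. \<phi> x + B c x) \<circ> (\<lambda>(u, v). u + v)) (U \<times> ?P) (quadratic_forms B)"
    by (rule bij_betw_trans[OF bij_betw_perp[OF U(1,2)] bij_betw_quadratic_shift[OF \<phi>]])
  then have bij: "bij_betw ?f (U \<times> ?P) (quadratic_forms B)"
    by (simp add: comp_def case_prod_unfold)
  have mem: "?f (u, v) \<in> ?D \<longleftrightarrow> u \<in> M \<and> v \<in> N" if "u \<in> U" "v \<in> ?P" for u v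
  proof -
    have "sign_sum (?f (u, v)) U = bit_sign (\<phi> u) * (a * 2 ^ d)"
      using sign_sum_shift[OF U(1) \<phi> that] a(2) by simp
    moreover have "u \<in> perp B ?P" using that(1) by (auto simp: perp_def commute)
    then have "sign_sum (?f (u, v)) ?P = bit_sign (\<phi> v) * (b * 2 ^ (n - d))"
      using sign_sum_shift[OF P(1) \<phi> that(2), of u] b(2) by (simp add: add.commute)
    moreover have "bit_sign (\<phi> u) * (a * 2 ^ d) = e * 2 ^ d \<longleftrightarrow> bit_sign (\<phi> u) = e * a"
      "bit_sign (\<phi> v) * (b * 2 ^ (n - d)) = e' * 2 ^ (n - d) \<longleftrightarrow> bit_sign (\<phi> v) = e' * b"
      using a(1) b(1) e by auto
    ultimately show ?thesis
      using that quadratic_shift[OF \<phi>, of "u + v"] by (simp add: M_def N_def)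
  qed
  have "?D = ?f ` (M \<times> N)"
  proof (intro subset_antisym subsetI)
    fix \<psi> assume \<psi>: "\<psi> \<in> ?D"
    then have "\<psi> \<in> ?f ` (U \<times> ?P)" using bij_betw_imp_surj_on[OF bij] by blast
    then obtain u v where "u \<in> U" "v \<in> ?P" "\<psi> = ?f (u, v)" by blast
    then show "\<psi> \<in> ?f ` (M \<times> N)" using mem[of u v] \<psi> by blast
  next
    fix \<psi> assume "\<psi> \<in> ?f ` (M \<times> N)"
    then obtain u v where "u \<in> M" "v \<in> N" "\<psi> = ?f (u, v)" by blast
    then show "\<psi> \<in> ?D" using mem[of u v] by (simp add: M_def N_def)
  qed
  moreover have "inj_on ?f (M \<times> N)"
    using bij_betw_imp_inj_on[OF bij] by (rule inj_on_subset) (auto simp: M_def N_def)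
  ultimately have "card ?D = card M * card N"
    by (simp add: card_image card_cartesian_product)
  moreover have "2 * int (card M) = 2 ^ d * (2 ^ d + e)"
  proof -
    have "2 * int (card M) = int (card U) + (e * a) * sign_sum \<phi> U"
      unfolding M_def by (rule card_bit_sign_eq) (use a e in auto)
    moreover have "(2::int) ^ (2 * d) = 2 ^ d * 2 ^ d" by (simp only: mult_2 power_add)
    ultimately show ?thesis
      using a e card_bit_subspace[OF U(1)] U(3) by (auto simp: distrib_left)
  qed
  moreover have "2 * int (card N) = 2 ^ (n - d) * (2 ^ (n - d) + e')"
  proof -
    have "2 * int (card N) = int (card ?P) + (e' * b) * sign_sum \<phi> ?P"
      unfolding N_def by (rule card_bit_sign_eq) (use b e in auto)
    moreover have "(2::int) ^ (2 * (n - d)) = 2 ^ (n - d) * 2 ^ (n - d)"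
      by (simp only: mult_2 power_add)
    ultimately show ?thesis
      using b e card_bit_subspace[OF P(1)] dP by (auto simp: distrib_left)
  qed
  \<comment> \<open>Both counts were doubled, hence the 4; it cancels against
    \<open>2 ^ d * 2 ^ (n - d) = 2 ^ (2 + (n - 2))\<close>.\<close>
  ultimately have "4 * int (card ?D) = (2 ^ d * (2 ^ d + e)) * (2 ^ (n - d) * (2 ^ (n - d) + e'))"
    by (simp flip: \<open>2 * int (card M) = _\<close> \<open>2 * int (card N) = _\<close>)
  also have "\<dots> = (2 ^ d * 2 ^ (n - d)) * ((2 ^ d + e) * (2 ^ (n - d) + e'))"
    by (simp only: ac_simps)
  also have "(2::int) ^ d * 2 ^ (n - d) = 2 ^ (2 + (n - 2))"
    using n(2,3) by (simp only: power_add[symmetric] le_add_diff_inverse)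
  finally show ?thesis by (simp only: power_add) simp
qed

text \<open>Sign sums multiply along the splitting, so of the signs on the whole space, on
  \<open>U\<close> and on \<open>perp B U\<close>, any two fix the third. The first description
  suits the group action, the second the count.\<close>

lemma Delta_set_eq:
  assumes U: "vec.subspace U" "nondegenerate_on B U" "vec.dim U = 2 * d"
    and n: "CARD('m) = 2 * n" "d \<le> n" and e: "\<epsilon> \<in> {1, -1}" "e' \<in> {1, -1}"
  shows "Delta_set B \<epsilon> e' U = {\<phi> \<in> quadratic_forms_of_type B \<epsilon>. sign_sum \<phi> U = e' * 2 ^ d}"
    and "Delta_set B \<epsilon> e' U = {\<phi> \<in> quadratic_forms B. sign_sum \<phi> U = e' * 2 ^ d \<and>
           sign_sum \<phi> (perp B U) = (\<epsilon> * e') * 2 ^ (n - d)}"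
proof -
  let ?P = "perp B U"
  note P = subspace_perp[of U] nondegenerate_perp[OF U(1,2)]
  have dP: "vec.dim ?P = 2 * (n - d)" using dim_perp[OF U(1,2)] n U(3) by simp
  have dV: "vec.dim (UNIV :: (bit ^ 'm) set) = 2 * n" using n by (simp add: vec.dim_UNIV card_cart_basis)
  have ee: "\<epsilon> * e' \<in> {1, -1}" using e by auto
  have pow: "(2::int) ^ n = 2 ^ d * 2 ^ (n - d)" using n by (simp flip: power_add)
  note V = has_type_on_iff_sign_sum[OF vec.subspace_UNIV nondegenerate_UNIV dV _ e(1)]
  have "has_type_on \<phi> UNIV \<epsilon> \<longleftrightarrow> sign_sum \<phi> ?P = (\<epsilon> * e') * 2 ^ (n - d)"
    if "\<phi> \<in> quadratic_forms B" "sign_sum \<phi> U = e' * 2 ^ d" for \<phi>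
    using V[OF that(1)] sign_sum_perp[OF U(1,2) that(1)] that(2) e pow by auto
  note * = this
  show "Delta_set B \<epsilon> e' U = {\<phi> \<in> quadratic_forms_of_type B \<epsilon>. sign_sum \<phi> U = e' * 2 ^ d}"
    unfolding Delta_set_def quadratic_forms_of_type_def
    using has_type_on_iff_sign_sum[OF U _ e(2)] has_type_on_iff_sign_sum[OF P dP _ ee] * by auto
  show "Delta_set B \<epsilon> e' U = {\<phi> \<in> quadratic_forms B. sign_sum \<phi> U = e' * 2 ^ d \<and>
           sign_sum \<phi> ?P = (\<epsilon> * e') * 2 ^ (n - d)}"
    unfolding Delta_set_def quadratic_forms_of_type_def
    using has_type_on_iff_sign_sum[OF U _ e(2)] has_type_on_iff_sign_sum[OF P dP _ ee] * by auto
qed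


section \<open>Conjugacy of nondegenerate subspaces\<close>

text \<open>Additivity already means linearity over this field. Only values on \<open>U\<close> are
  constrained, and injectivity follows when \<open>U\<close> is a nondegenerate subspace.\<close>

definition isometry_betw :: "(bit ^ 'm) set \<Rightarrow> (bit ^ 'm) set \<Rightarrow> (bit ^ 'm \<Rightarrow> bit ^ 'm) \<Rightarrow> bool" where
  "isometry_betw U U' f \<longleftrightarrow> (\<forall>x\<in>U. \<forall>y\<in>U. f (x + y) = f x + f y) \<and>
     (\<forall>x\<in>U. \<forall>y\<in>U. B (f x) (f y) = B x y) \<and> f ` U = U'"

lemma isometry_inj:
  assumes U: "nondegenerate_on B U" "vec.subspace U"
    and iso: "\<And>x y. x \<in> U \<Longrightarrow> y \<in> U \<Longrightarrow> B (f x) (f y) = B x y"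
  shows "inj_on f U"
proof (rule inj_onI)
  fix x y assume xy: "x \<in> U" "y \<in> U" "f x = f y"
  have "B z (x + y) = 0" if "z \<in> U" for z
    using iso[OF that xy(1)] iso[OF that xy(2)] xy(3) by (simp add: add_right)
  then have "x + y \<in> U \<inter> perp B U"
    using vec.subspace_add[OF U(2) xy(1,2)] by (simp add: perp_def)
  then have "x + y = 0" using U(1) by (auto simp: nondegenerate_on_def)
  then show "x = y" by (simp add: bit_vec_add_eq_0_iff)
qed

text \<open>Peels off the hyperbolic plane spanned by \<open>e\<close> and \<open>f\<close>, for
  induction on the size of \<open>U\<close>. The vector in the last clause is the orthogonal
  projection of \<open>x\<close> to the complement of the plane.\<close>

lemma hyperbolic_split:
  assumes U: "vec.subspace U" "nondegenerate_on B U" "U \<noteq> {0}"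
  obtains e f where "e \<in> U" "f \<in> U" "B e f = 1"
    "vec.subspace (U \<inter> perp B {e, f})" "nondegenerate_on B (U \<inter> perp B {e, f})"
    "4 * card (U \<inter> perp B {e, f}) = card U"
    "\<And>x. x \<in> U \<Longrightarrow> x + (B x f *s e + B e x *s f) \<in> U \<inter> perp B {e, f}"
proof -
  obtain e where e: "e \<in> U" "e \<noteq> 0" using U(3) vec.subspace_0[OF U(1)] by auto
  then have "e \<notin> perp B U" using U(2) by (auto simp: nondegenerate_on_def)
  then obtain f where f: "f \<in> U" "B e f = 1" by (auto simp: perp_def commute)
  let ?U1 = "U \<inter> perp B {e, f}"
  have B: "B f e = 1" using f commute by metis
  have sub: "vec.subspace ?U1" by (rule vec.subspace_inter[OF U(1) subspace_perp])
  have proj: "x + (B x f *s e + B e x *s f) \<in> ?U1" if "x \<in> U" for x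
    using that e f B
    by (auto simp: perp_def add_right scale_right commute[of x]
        intro!: vec.subspace_add[OF U(1)] vec.subspace_scale[OF U(1)])
  have nd: "nondegenerate_on B ?U1"
  proof -
    have "x = 0" if x: "x \<in> ?U1" "x \<in> perp B ?U1" for x
    proof -
      have "B y x = 0" if y: "y \<in> U" for y
      proof -
        \<comment> \<open>\<open>x\<close> is orthogonal to \<open>e\<close> and \<open>f\<close>,
          so projecting \<open>y\<close> does not change its product with \<open>x\<close>.\<close>
        have "B (y + (B y f *s e + B e y *s f)) x = 0"
          using proj[OF y] x(2) by (auto simp: perp_def)
        then show ?thesis using x(1) by (simp add: perp_def add_left scale_left)
      qed
      then show ?thesis using x(1) U(2) by (auto simp: nondegenerate_on_def perp_def)
    qed
    then show ?thesis
      using vec.subspace_0[OF sub] vec.subspace_0[OF subspace_perp] by (auto simp: nondegenerate_on_def)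
  qed
  let ?H = "{0, e, f, e + f}"
  have "e \<noteq> f" "f \<noteq> 0" using f by auto
  then have "card ?H = 4" using e(2) by (auto simp: bit_vec_add_eq_0_iff)
  moreover have "vec.subspace ?H"
    by (rule bit_subspaceI) (auto simp: ac_simps)
  moreover have "?H \<subseteq> U" using e f vec.subspace_0[OF U(1)] vec.subspace_add[OF U(1)] by auto
  moreover have "perp B ?H = perp B {e, f}" by (auto simp: perp_def add_left)
  ultimately have "4 * card ?U1 = card U" using card_perp[OF U(1,2)] by metis
  then show ?thesis using that[OF e(1) f sub nd] proj by blast
qed

lemma hyperbolic_expand:
  assumes "B e f = 1" and "w \<in> perp B {e, f}" "z \<in> perp B {e, f}"
  shows "B ((a *s e + b *s f) + w) ((c *s e + d *s f) + z) = a * d + b * c + B w z"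
proof -
  have "B f e = 1" using assms(1) commute by metis
  moreover have "B e w = 0" "B f w = 0" "B e z = 0" "B f z = 0" "B w e = 0" "B w f = 0"
    using assms(2,3) by (auto simp: perp_def commute[of w])
  ultimately show ?thesis
    by (simp add: add_left add_right scale_left scale_right assms(1))
qed

text \<open>Split a hyperbolic pair off each side: the complements are isometric by induction, and
  the pairs are matched.\<close>

lemma exists_isometry:
  assumes "vec.subspace U" "nondegenerate_on B U" "vec.subspace U'" "nondegenerate_on B U'"
    and "card U = card U'"
  shows "\<exists>f. isometry_betw U U' f"
  using assms
proof (induction "card U" arbitrary: U U' rule: less_induct)
  case less
  note U = less.prems(1,2) and U' = less.prems(3,4) and cUU' = less.prems(5)
  show ?case
  proof (cases "U = {0}")
    case True
    then have "card U' = 1" using cUU' by simp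
    then have "U' = {0}" using vec.subspace_0[OF U'(1)] by (auto simp: card_1_singleton_iff)
    then show ?thesis using True by (intro exI[of _ id]) (auto simp: isometry_betw_def)
  next
    case False
    have False': "U' \<noteq> {0}"
    proof
      assume "U' = {0}"
      then have "card U = 1" using cUU' by simp
      then show False using False vec.subspace_0[OF U(1)] by (auto simp: card_1_singleton_iff)
    qed
    obtain e f where ef: "e \<in> U" "f \<in> U" "B e f = 1"
      and U1: "vec.subspace (U \<inter> perp B {e, f})" "nondegenerate_on B (U \<inter> perp B {e, f})"
      and c: "4 * card (U \<inter> perp B {e, f}) = card U"
      and p: "\<And>x. x \<in> U \<Longrightarrow> x + (B x f *s e + B e x *s f) \<in> U \<inter> perp B {e, f}"
      using hyperbolic_split[OF U False] by blast
    obtain e' f' where ef': "e' \<in> U'" "f' \<in> U'" "B e' f' = 1"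
      and U1': "vec.subspace (U' \<inter> perp B {e', f'})" "nondegenerate_on B (U' \<inter> perp B {e', f'})"
      and c': "4 * card (U' \<inter> perp B {e', f'}) = card U'"
      using hyperbolic_split[OF U' False'] by blast
    have "0 < card U" using vec.subspace_0[OF U(1)] by (auto simp: card_gt_0_iff)
    then have "card (U \<inter> perp B {e, f}) < card U" using c by linarith
    then obtain g where g: "isometry_betw (U \<inter> perp B {e, f}) (U' \<inter> perp B {e', f'}) g"
      using less.hyps[OF _ U1 U1'] c c' cUU' by auto
    define q where "q x = x + (B x f *s e + B e x *s f)" for x
    \<comment> \<open>\<open>B x f\<close> and \<open>B e x\<close> are the coordinates of
      \<open>x\<close> along \<open>e\<close> and \<open>f\<close>, and \<open>q x\<close> is the
      rest; \<open>F\<close> keeps the coordinates and applies \<open>g\<close> to the rest.\<close>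
    define F where "F x = (B x f *s e' + B e x *s f') + g (q x)" for x
    have q: "q x \<in> U \<inter> perp B {e, f}" if "x \<in> U" for x using p[OF that] by (simp add: q_def)
    have gq: "g (q x) \<in> U' \<inter> perp B {e', f'}" if "x \<in> U" for x
      using g q[OF that] unfolding isometry_betw_def by blast
    have xq: "x = (B x f *s e + B e x *s f) + q x" for x
      unfolding q_def by (metis add.commute bit_vec_add_self_left)
    have iso: "B (F x) (F y) = B x y" if xy: "x \<in> U" "y \<in> U" for x y
    proof -
      have "B (F x) (F y) = B x f * B e y + B e x * B y f + B (g (q x)) (g (q y))"
        unfolding F_def by (rule hyperbolic_expand) (use gq xy ef' in auto)
      also have "B (g (q x)) (g (q y)) = B (q x) (q y)"
        using g q xy by (auto simp: isometry_betw_def)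
      also have "B x f * B e y + B e x * B y f + B (q x) (q y)
        = B ((B x f *s e + B e x *s f) + q x) ((B y f *s e + B e y *s f) + q y)"
        by (rule hyperbolic_expand[symmetric]) (use q xy ef in auto)
      finally show ?thesis by (simp only: xq[symmetric])
    qed
    have add: "F (x + y) = F x + F y" if xy: "x \<in> U" "y \<in> U" for x y
    proof -
      have "q (x + y) = q x + q y"
        by (simp only: q_def add_left add_right vec.scale_left_distrib add_ac)
      moreover have "g (q x + q y) = g (q x) + g (q y)"
        using g q xy by (auto simp: isometry_betw_def)
      ultimately show ?thesis
        by (simp only: F_def add_left add_right vec.scale_left_distrib add_ac)
    qed
    have "F ` U \<subseteq> U'"
      using gq ef' by (auto simp: F_def intro!: vec.subspace_add[OF U'(1)] vec.subspace_scale[OF U'(1)])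
    moreover have "card (F ` U) = card U'"
      using card_image[OF isometry_inj[OF U(2,1) iso]] cUU' by simp
    ultimately have "F ` U = U'" by (intro card_subset_eq) auto
    then have "isometry_betw U U' F" using iso add by (simp add: isometry_betw_def)
    then show ?thesis by blast
  qed
qed

text \<open>An isometry from \<open>U\<close> to \<open>U'\<close> and one between their
  perpendicular spaces glue to an isometry of the whole space.\<close>

lemma Sp_transitive_nondegenerate:
  assumes U: "vec.subspace U" "nondegenerate_on B U"
    and U': "vec.subspace U'" "nondegenerate_on B U'" and dim: "vec.dim U = vec.dim U'"
  obtains g where "g \<in> carrier (Sp B)" "g ` U = U'"
proof -
  let ?P = "perp B U" and ?P' = "perp B U'"
  note P = subspace_perp[of U] nondegenerate_perp[OF U]
  note P' = subspace_perp[of U'] nondegenerate_perp[OF U']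
  have "card U = card U'"
    using dim by (simp add: card_bit_subspace U(1) U'(1))
  then obtain f1 where f1: "isometry_betw U U' f1" using exists_isometry[OF U U'] by blast
  have "vec.dim ?P = vec.dim ?P'" using dim_perp[OF U] dim_perp[OF U'] dim by linarith
  then have "card ?P = card ?P'" by (simp add: card_bit_subspace subspace_perp)
  then obtain f2 where f2: "isometry_betw ?P ?P' f2" using exists_isometry[OF P P'] by blast
  let ?s = "\<lambda>(u, v). u + v"
  define g where "g x = (\<lambda>(u, v). f1 u + f2 v) (inv_into (U \<times> ?P) ?s x)" for x
  have g: "g (u + v) = f1 u + f2 v" if "u \<in> U" "v \<in> ?P" for u v
    using inv_into_f_f[OF bij_betw_imp_inj_on[OF bij_betw_perp[OF U]], of "(u, v)"] that
    by (simp add: g_def)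
  have f1U: "f1 u \<in> U'" if "u \<in> U" for u using f1 that by (auto simp: isometry_betw_def)
  have f2P: "f2 v \<in> ?P'" if "v \<in> ?P" for v using f2 that by (auto simp: isometry_betw_def)
  have orth: "B u v = 0" "B v u = 0" if "u \<in> W" "v \<in> perp B W" for u v W
    using that by (auto simp: perp_def commute)
  have add: "g (x + y) = g x + g y" for x y
  proof -
    obtain u v where x: "u \<in> U" "v \<in> ?P" "x = u + v" by (rule perp_decompose[OF U])
    obtain u' v' where y: "u' \<in> U" "v' \<in> ?P" "y = u' + v'" by (rule perp_decompose[OF U])
    have "x + y = (u + u') + (v + v')" unfolding x(3) y(3) by (simp only: add_ac)
    then have "g (x + y) = f1 (u + u') + f2 (v + v')"
      using g[OF vec.subspace_add[OF U(1) x(1) y(1)] vec.subspace_add[OF P(1) x(2) y(2)]] by simp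
    also have "\<dots> = (f1 u + f1 u') + (f2 v + f2 v')"
      using f1 f2 x y by (simp add: isometry_betw_def)
    also have "\<dots> = g x + g y"
      unfolding x(3) y(3) g[OF x(1,2)] g[OF y(1,2)] by (simp only: add_ac)
    finally show ?thesis .
  qed
  have iso: "B (g x) (g y) = B x y" for x y
  proof -
    obtain u v where x: "u \<in> U" "v \<in> ?P" "x = u + v" by (rule perp_decompose[OF U])
    obtain u' v' where y: "u' \<in> U" "v' \<in> ?P" "y = u' + v'" by (rule perp_decompose[OF U])
    have "B (g x) (g y) = B (f1 u) (f1 u') + B (f2 v) (f2 v')"
      unfolding x(3) y(3) g[OF x(1,2)] g[OF y(1,2)]
      by (simp add: add_left add_right orth[OF f1U f2P] x y)
    also have "\<dots> = B u u' + B v v'" using f1 f2 x y by (simp add: isometry_betw_def)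
    also have "\<dots> = B x y"
      unfolding x(3) y(3) by (simp add: add_left add_right orth[OF x(1) y(2)] orth[OF y(1) x(2)])
    finally show ?thesis .
  qed
  have g0: "g 0 = 0" using add[of 0 0] by simp
  have "Vector_Spaces.linear (*s) (*s) g"
    unfolding Vector_Spaces.linear_iff
    by (auto simp: add bit_scale_cases g0 vec.vector_space_axioms)
  moreover have "inj g" by (rule isometry_inj[OF nondegenerate_UNIV]) (auto simp: iso)
  then have "bij g" by (simp add: bij_def finite_UNIV_inj_surj)
  ultimately have "g \<in> carrier (Sp B)" using iso by (simp add: Sp_def)
  \<comment> \<open>This makes \<open>g\<close> agree with \<open>f1\<close> on \<open>U\<close>,
    where the second component is 0.\<close>
  moreover have "f2 0 = 0"
    using f2 vec.subspace_0[OF P(1)] unfolding isometry_betw_def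
    by (metis add.right_neutral add_left_cancel)
  then have "g u = f1 u" if "u \<in> U" for u
    using g[OF that vec.subspace_0[OF P(1)]] by simp
  then have "g ` U = U'" using f1 by (auto simp: isometry_betw_def)
  ultimately show ?thesis by (rule that)
qed

section \<open>Isometries acting on subspaces and on level sets of sign sums\<close>

lemma Sp_image_nondegenerate:
  assumes U: "nondegenerate_on B U" and g: "g \<in> carrier (Sp B)"
  shows "nondegenerate_on B (g ` U)"
proof -
  have lin: "Vector_Spaces.linear (*s) (*s) g" and iso: "\<And>x y. B (g x) (g y) = B x y"
    using g by (auto simp: Sp_def)
  have g0: "g 0 = 0" by (rule vec.linear_0[OF lin])
  have "0 \<in> U" using U by (auto simp: nondegenerate_on_def)
  then have "0 \<in> g ` U" using g0 by (metis imageI)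
  then have "0 \<in> g ` U \<inter> perp B (g ` U)" by (simp add: perp_def)
  moreover have "x = 0" if x: "x \<in> g ` U \<inter> perp B (g ` U)" for x
  proof -
    obtain u where u: "u \<in> U" "x = g u" using x by blast
    then have "u \<in> U \<inter> perp B U" using x by (simp add: perp_def iso)
    then have "u = 0" using U unfolding nondegenerate_on_def by blast
    then show ?thesis using g0 u(2) by simp
  qed
  ultimately show ?thesis unfolding nondegenerate_on_def by blast
qed

text \<open>The action composes with the inverse of \<open>g\<close>, so the new form has at
  \<open>g x\<close> the value \<open>\<phi> x\<close>.\<close>

lemma sign_sum_form_action:
  assumes g: "g \<in> carrier (Sp B)" and \<phi>: "\<phi> \<in> quadratic_forms_of_type B \<epsilon>"
  shows "sign_sum (form_action B \<epsilon> g \<phi>) (g ` U) = sign_sum \<phi> U"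
proof -
  have "inj g" using g by (auto simp: Sp_def bij_is_inj)
  then show ?thesis
    using \<phi> by (simp add: sign_sum_def form_action_def sum.reindex inj_on_subset[OF _ subset_UNIV])
qed

lemma form_action_level_set:
  assumes g: "g \<in> carrier (Sp B)"
  shows "form_action B \<epsilon> g ` {\<phi> \<in> quadratic_forms_of_type B \<epsilon>. sign_sum \<phi> U = s}
       = {\<phi> \<in> quadratic_forms_of_type B \<epsilon>. sign_sum \<phi> (g ` U) = s}" (is "?L = ?R")
proof (intro subset_antisym subsetI)
  show "\<phi> \<in> ?R" if "\<phi> \<in> ?L" for \<phi>
    using that by (auto simp: form_action_closed[OF g] sign_sum_form_action[OF g])
next
  fix \<psi> assume \<psi>: "\<psi> \<in> ?R"
  have "bij g" using g by (simp add: Sp_def)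
  define \<phi> where "\<phi> = (\<lambda>x. \<psi> (g x))"
  have \<phi>: "\<phi> \<in> quadratic_forms_of_type B \<epsilon>"
    using quadratic_forms_of_type_compose[OF g] \<psi> by (simp add: \<phi>_def)
  have "form_action B \<epsilon> g \<phi> = \<psi>"
    using \<phi> \<open>bij g\<close> by (simp add: form_action_def) (simp add: \<phi>_def bij_is_surj surj_f_inv_f)
  moreover from this have "sign_sum \<phi> U = s" using sign_sum_form_action[OF g \<phi>, of U] \<psi> by simp
  ultimately show "\<psi> \<in> ?L" using \<phi> by blast
qed

end

section \<open>Codes whose stabilisers preserve a nondegenerate subspace\<close>

theorem theorem5p5:
  fixes B :: "bit ^ 'm::finite \<Rightarrow> bit ^ 'm \<Rightarrow> bit"
    and n d k :: nat
    and \<epsilon> :: int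
    and \<Gamma> :: "(bit ^ 'm \<Rightarrow> bit) set set"
    and \<Delta> :: "(bit ^ 'm \<Rightarrow> bit) set"
    and U :: "(bit ^ 'm) set"
  assumes "n \<ge> 2"
    and "CARD('m) = 2 * n"
    and "symplectic_form B"
    and "\<epsilon> \<in> {1, -1}"
    and "2 \<le> k" and "k + 2 \<le> card (quadratic_forms_of_type B \<epsilon>)"
    and "johnson_code (quadratic_forms_of_type B \<epsilon>) k \<Gamma>"
    and "strongly_incidence_transitive (Sp B) (form_action B \<epsilon>) (quadratic_forms_of_type B \<epsilon>) \<Gamma>"
    and "\<Delta> \<in> \<Gamma>"
    and "1 \<le> d" and "d \<le> n - 1"
    and "vec.subspace U" and "nondegenerate_on B U" and "vec.dim U = 2 * d"
    and "setwise_stabiliser (Sp B) (form_action B \<epsilon>) \<Delta> \<subseteq> setwise_stabiliser (Sp B) (\<lambda>g. g) U"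
  shows "\<exists>\<epsilon>' \<in> {1, -1}.
           \<Gamma> = Gamma_code B d \<epsilon> \<epsilon>' \<and>
           int k = 2 ^ (n - 2) * (2 ^ d + \<epsilon>') * (2 ^ (n - d) + \<epsilon> * \<epsilon>') \<and>
           (n, d, \<epsilon>) \<noteq> (2, 1, 1)"
proof -
  interpret symplectic B by unfold_locales fact
  let ?Q = "quadratic_forms_of_type B \<epsilon>"
  let ?act = "form_action B \<epsilon>"
  note n = assms(1,2) and eps = assms(4) and U = assms(12-14)
  have dn: "d \<le> n" using assms(11) by simp
  have sit: "\<And>g D. g \<in> carrier (Sp B) \<Longrightarrow> D \<in> \<Gamma> \<Longrightarrow> ?act g ` D \<in> \<Gamma>"
    "\<And>D D'. D \<in> \<Gamma> \<Longrightarrow> D' \<in> \<Gamma> \<Longrightarrow> \<exists>g \<in> carrier (Sp B). ?act g ` D = D'"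
    "\<And>a b a' b'. a \<in> \<Delta> \<Longrightarrow> b \<in> ?Q - \<Delta> \<Longrightarrow> a' \<in> \<Delta> \<Longrightarrow> b' \<in> ?Q - \<Delta> \<Longrightarrow>
        \<exists>g \<in> setwise_stabiliser (Sp B) ?act \<Delta>. ?act g a = a' \<and> ?act g b = b'"
    using assms(8,9) unfolding strongly_incidence_transitive_def by simp_all
  have \<Delta>: "\<Delta> \<subseteq> ?Q" "card \<Delta> = k"
    using assms(7,9) by (auto simp: johnson_code_def johnson_vertices_def)
  have cc: "card (?Q - \<Delta>) \<ge> 2"
    using \<Delta> assms(6) by (simp add: card_Diff_subset)
  have "\<Delta> \<noteq> {}" "?Q - \<Delta> \<noteq> {}" using \<Delta>(2) assms(5) cc by force+
  then obtain \<alpha> \<beta> where \<alpha>: "\<alpha> \<in> \<Delta>" and \<beta>: "\<beta> \<in> ?Q - \<Delta>" by blast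
  have quad: "\<phi> \<in> quadratic_forms B" if "\<phi> \<in> ?Q" for \<phi>
    using that by (simp add: quadratic_forms_of_type_def)
  \<comment> \<open>The stabiliser of \<open>\<Delta>\<close> fixes \<open>U\<close> setwise, so it
    only permutes the terms of the sum.\<close>
  have inv: "sign_sum (?act g \<phi>) U = sign_sum \<phi> U"
    if "g \<in> setwise_stabiliser (Sp B) ?act \<Delta>" "\<phi> \<in> ?Q" for g \<phi>
  proof -
    have "g \<in> setwise_stabiliser (Sp B) (\<lambda>g. g) U" using that(1) assms(15) by blast
    then have "g \<in> carrier (Sp B)" "g ` U = U" by (auto simp: setwise_stabiliser_def)
    then show ?thesis using sign_sum_form_action[OF _ that(2), of g U] by simp
  qed
  \<comment> \<open>Keeping one entry of the pair in
    \<open>\<Delta> \<times> (?Q - \<Delta>)\<close> fixed leaves transitivity on the other.\<close>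
  have const\<Delta>: "sign_sum \<phi> U = sign_sum \<alpha> U" if "\<phi> \<in> \<Delta>" for \<phi>
    using sit(3)[OF \<alpha> \<beta> that \<beta>] inv \<alpha> \<Delta>(1) by blast
  have const\<Delta>c: "sign_sum \<phi> U = sign_sum \<beta> U" if "\<phi> \<in> ?Q - \<Delta>" for \<phi>
    using sit(3)[OF \<alpha> \<beta> \<alpha> that] inv \<beta> by blast
  have "\<alpha> \<in> quadratic_forms B" using \<alpha> \<Delta>(1) quad by blast
  then obtain e where e: "e \<in> {1, -1}" "sign_sum \<alpha> U = e * 2 ^ d"
    by (rule sign_sum_cases[OF U])
  have me: "- e \<in> {1, -1}" using e(1) by auto
  \<comment> \<open>The sign of \<open>\<Delta>\<close> will give \<open>k\<close>; the opposite
    sign gives a nonempty set, later seen to be the complement of \<open>\<Delta>\<close>.\<close>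
  have cardD: "int (card (Delta_set B \<epsilon> e' U)) = 2 ^ (n - 2) * (2 ^ d + e') * (2 ^ (n - d) + \<epsilon> * e')"
    if "e' \<in> {1, -1}" for e'
    unfolding Delta_set_eq(2)[OF U n(2) dn eps that]
    by (rule card_sign_sum_pair[OF U n(2,1) dn _ that]) (use \<open>\<alpha> \<in> quadratic_forms B\<close> eps that in auto)
  \<comment> \<open>Since \<open>1 \<le> d\<close> and \<open>d \<le> n - 1\<close>, no factor of
    the count vanishes even for sign -1.\<close>
  have "(2::int) ^ d \<ge> 2 ^ 1" "(2::int) ^ (n - d) \<ge> 2 ^ 1"
    using assms(1,10,11) by (intro power_increasing; simp)+
  then have "int (card (Delta_set B \<epsilon> (- e) U)) > 0"
    unfolding cardD[OF me] using e(1) eps by (intro mult_pos_pos) auto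
  then have "Delta_set B \<epsilon> (- e) U \<noteq> {}" by auto
  \<comment> \<open>A form of type \<open>\<epsilon>\<close> with the opposite sign on
    \<open>U\<close>. It cannot lie in \<open>\<Delta>\<close>, so it determines the constant value
    on the complement, which thus differs from that on \<open>\<Delta>\<close>.\<close>
  then obtain \<gamma> where \<gamma>: "\<gamma> \<in> ?Q" "sign_sum \<gamma> U = - e * 2 ^ d"
    unfolding Delta_set_eq(1)[OF U n(2) dn eps me] by auto
  have e0: "e * 2 ^ d \<noteq> - e * 2 ^ d" using e(1) by auto
  have "\<gamma> \<notin> \<Delta>" using const\<Delta>[of \<gamma>] \<gamma> e e0 by auto
  then have "sign_sum \<beta> U = - e * 2 ^ d" using const\<Delta>c[of \<gamma>] \<gamma> by simp
  then have split: "sign_sum \<phi> U = (if \<phi> \<in> \<Delta> then e * 2 ^ d else - e * 2 ^ d)" if "\<phi> \<in> ?Q" for \<phi>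
    using const\<Delta>[of \<phi>] const\<Delta>c[of \<phi>] that e(2) by simp
  have \<Delta>eq: "\<Delta> = Delta_set B \<epsilon> e U" and \<Delta>c: "?Q - \<Delta> = Delta_set B \<epsilon> (- e) U"
    unfolding Delta_set_eq(1)[OF U n(2) dn eps e(1)] Delta_set_eq(1)[OF U n(2) dn eps me]
    using split \<Delta>(1) e0 by (auto split: if_splits)
  \<comment> \<open>Every codeword is an image of \<open>\<Delta>\<close>; this makes it the level
    set attached to the image of \<open>U\<close>.\<close>
  have move: "?act g ` \<Delta> = Delta_set B \<epsilon> e (g ` U) \<and> vec.subspace (g ` U) \<and>
      nondegenerate_on B (g ` U) \<and> vec.dim (g ` U) = 2 * d" if g: "g \<in> carrier (Sp B)" for g
  proof -
    have lin: "Vector_Spaces.linear (*s) (*s) g" and "inj g"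
      using g by (auto simp: Sp_def bij_is_inj)
    have gU: "vec.subspace (g ` U)" by (rule vec.linear_subspace_image[OF lin U(1)])
    have "inj_on g (vec.span U)" using \<open>inj g\<close> by (rule inj_on_subset) simp
    then have dim: "vec.dim (g ` U) = 2 * d" using vec.dim_image_eq[OF lin] U(3) by simp
    note gU = gU Sp_image_nondegenerate[OF U(2) g] dim
    show ?thesis
      using gU Delta_set_eq(1)[OF gU n(2) dn eps e(1)] form_action_level_set[OF g]
        Delta_set_eq(1)[OF U n(2) dn eps e(1)] \<Delta>eq by simp
  qed
  have "\<Gamma> = Gamma_code B d \<epsilon> e"
  proof (intro subset_antisym subsetI)
    fix D assume "D \<in> \<Gamma>"
    then obtain g where "g \<in> carrier (Sp B)" "D = ?act g ` \<Delta>" using sit(2)[OF assms(9)] by blast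
    then show "D \<in> Gamma_code B d \<epsilon> e" using move unfolding Gamma_code_def by blast
  next
    fix D assume "D \<in> Gamma_code B d \<epsilon> e"
    then obtain U' where U': "vec.subspace U'" "nondegenerate_on B U'" "vec.dim U' = 2 * d"
      and D: "D = Delta_set B \<epsilon> e U'" by (auto simp: Gamma_code_def)
    obtain g where "g \<in> carrier (Sp B)" "g ` U = U'"
      using Sp_transitive_nondegenerate[OF U(1,2) U'(1,2)] U(3) U'(3) by metis
    then show "D \<in> \<Gamma>" using move D sit(1)[OF _ assms(9)] by metis
  qed
  moreover have k: "int k = 2 ^ (n - 2) * (2 ^ d + e) * (2 ^ (n - d) + \<epsilon> * e)"
    using cardD[OF e(1)] \<Delta>eq \<Delta>(2) by simp
  \<comment> \<open>Here \<open>\<Delta>\<close> and its complement would have sizes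
    \<open>(2 + e)\<^sup>2\<close> and \<open>(2 - e)\<^sup>2\<close>, so one of them would have a
    single element, against the bounds on \<open>k\<close>.\<close>
  moreover have "(n, d, \<epsilon>) \<noteq> (2, 1, 1)"
  proof
    assume "(n, d, \<epsilon>) = (2, 1, 1)"
    then have "int k = (2 + e) * (2 + e)" "int (card (?Q - \<Delta>)) = (2 - e) * (2 - e)"
      using k cardD[OF me] \<Delta>c by simp_all
    then show False using e(1) assms(5) cc by auto
  qed
  ultimately show ?thesis using e(1) by blast
qed

end
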